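(* Let $\hat U_r=(\hat u_r,\hat E_r,\hat B_r)^T$ (with $\hat u_r,\hat E_r,\hat B_r\in\mathbb{C}^2$) be a solution of $$\partial_t\begin{pmatrix}\hat u_r\\ \hat E_r\\ \hat B_r\end{pmatrix}=-\hat A_r\begin{pmatrix}\hat u_r\\ \hat E_r\\ \hat B_r\end{pmatrix},\qquad \hat A_r=\begin{pmatrix}\mathbb{I}_2-\mathbb{O}_1&\mathbb{I}_2&0\\-\mathbb{I}_2&0&-ik\mathbb{O}_1\\0&ik\mathbb{O}_1&0\end{pmatrix},$$ for all $t\ge0$, $k\in\mathbb{R}$, with initial data $(\hat u_{r0},\hat E_{r0},\hat B_{r0})^T$ at $t=0$. Then $$\begin{pmatrix}\hat u_r(t,k)\\ \hat E_r(t,k)\\ \hat B_r(t,k)\end{pmatrix}=\hat G_e(t,k)\begin{pmatrix}\hat u_{r0}\\ \hat E_{r0}\\ \hat B_{r0}\end{pmatrix},\qquad \hat G_e=\sum_{j=1}^3P_je^{\lambda_jt}+\sum_{l=4}^6P_le^{\lambda_lt},$$ where, for $j=1,2,3$ and with $Q_+=\mathbb{I}_2+i\mathbb{O}_1$, $$P_j=-\frac{\lambda_j\Lambda_j}{2\prod_{n\in\{1,2,3\},\,n\ne j}(\lambda_j-\lambda_n)}\begin{pmatrix}-\frac1{\Lambda_j^2}Q_+&\frac1{\Lambda_j}Q_+&\frac{k}{\lambda_j\Lambda_j}Q_+\\ -\frac1{\Lambda_j}Q_+&Q_+&\frac{k}{\lambda_j}Q_+\\ \frac{k}{\lambda_j\Lambda_j}Q_+&-\frac{k}{\lambda_j}Q_+&-\frac{k^2}{\lambda_j^2}Q_+\end{pmatrix},$$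 and, for $l=4,5,6$ and with $Q_-=\mathbb{I}_2-i\mathbb{O}_1$, $$P_l=-\frac{\lambda_l\Omega_l}{2\prod_{m\in\{4,5,6\},\,m\ne l}(\lambda_l-\lambda_m)}\begin{pmatrix}-\frac1{\Omega_l^2}Q_-&\frac1{\Omega_l}Q_-&-\frac{k}{\lambda_l\Omega_l}Q_-\\ -\frac1{\Omega_l}Q_-&Q_-&-\frac{k}{\lambda_l}Q_-\\ -\frac{k}{\lambda_l\Omega_l}Q_-&\frac{k}{\lambda_l}Q_-&-\frac{k^2}{\lambda_l^2}Q_-\end{pmatrix}.$$
   Context: $\mathbb{I}_2$ is the $2\times2$ identity and $\mathbb{O}_1=\begin{pmatrix}0&-1\\1&0\end{pmatrix}$. $\lambda_1,\lambda_2,\lambda_3$ are the three roots of $g^+(\lambda)=\lambda^3+(1+i)\lambda^2+(k^2+1)\lambda+(1+i)k^2=0$ and $\lambda_4,\lambda_5,\lambda_6$ the three roots of $g^-(\lambda)=\lambda^3+(1-i)\lambda^2+(k^2+1)\lambda+(1-i)k^2=0$, labelled so that $\lambda_{j+3}=\overline{\lambda_j}$; one has $\det(\lambda\mathbb{I}_6+\hat A_r)=g^+(\lambda)g^-(\lambda)$. $\Lambda_j=\sum_{n\in\{1,2,3\},\,n\ne j}\lambda_n$ for $j=1,2,3$ and $\Omega_l=\sum_{m\in\{4,5,6\},\,m\neq l}\lambda_m$ for $l=4,5,6$. At $k=0$, where $\lambda_1=\lambda_4=0$, the entries of $P_1,P_4$ are understood as their limits as $k\to0$. *)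

theory Defs
  imports "HOL-Analysis.Analysis" "HOL-Computational_Algebra.Computational_Algebra"
begin

text \<open>
  \<open>\<complex>\<^sup>6\<close> and the \<open>6 \<times> 6\<close> matrices are indexed by the six-element type \<^typ>\<open>3 \<times> 2\<close>: the first
  component selects the block (velocity, electric field, magnetic field), the second one the entry
  inside the block.
\<close>

type_synonym state = "complex ^ (3 \<times> 2)"
type_synonym state_mat = "complex ^ (3 \<times> 2) ^ (3 \<times> 2)"

definition stack :: "complex ^ 2 \<Rightarrow> complex ^ 2 \<Rightarrow> complex ^ 2 \<Rightarrow> state" where
  "stack u E B = (\<chi> p. (vector [u, E, B] :: complex ^ 2 ^ 3) $ fst p $ snd p)"

definition blocks :: "complex ^ 2 ^ 2 ^ 3 ^ 3 \<Rightarrow> state_mat" where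
  "blocks M = (\<chi> p q. M $ fst p $ fst q $ snd p $ snd q)"

definition scale_mat :: "complex \<Rightarrow> complex ^ 'n ^ 'm \<Rightarrow> complex ^ 'n ^ 'm" (infixr "*\<^sub>M" 75) where
  "c *\<^sub>M M = (\<chi> i j. c * M $ i $ j)"

definition I2 :: "complex ^ 2 ^ 2" where
  "I2 = mat 1"

definition O1 :: "complex ^ 2 ^ 2" where
  "O1 = vector [vector [0, -1], vector [1, 0]]"

definition Qp :: "complex ^ 2 ^ 2" where
  "Qp = I2 + \<i> *\<^sub>M O1"

definition Qm :: "complex ^ 2 ^ 2" where
  "Qm = I2 - \<i> *\<^sub>M O1"

definition A_r :: "real \<Rightarrow> state_mat" where
  "A_r k = blocks (vector
     [vector [I2 - O1, I2,                      0],
      vector [- I2,    0,                       - (\<i> * of_real k) *\<^sub>M O1],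
      vector [0,       (\<i> * of_real k) *\<^sub>M O1, 0]])"

definition g_plus :: "real \<Rightarrow> complex poly" where
  "g_plus k = [: (1 + \<i>) * of_real k ^ 2, of_real k ^ 2 + 1, 1 + \<i>, 1 :]"

definition g_minus :: "real \<Rightarrow> complex poly" where
  "g_minus k = [: (1 - \<i>) * of_real k ^ 2, of_real k ^ 2 + 1, 1 - \<i>, 1 :]"

text \<open>
  \<open>lam j k\<close> is the root \<open>\<lambda>\<^sub>j\<close> at frequency \<open>k\<close>, for \<open>j = 1, \<dots>, 6\<close>. The last clause makes the
  labelling of the first root continuous at \<open>k = 0\<close>; without it the limits of \<open>P\<^sub>1\<close> and \<open>P\<^sub>4\<close> as
  \<open>k \<rightarrow> 0\<close> would be meaningless, since the three roots could be permuted arbitrarily at each \<open>k\<close>.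
  It does not restrict the labelling at any single \<open>k \<noteq> 0\<close>.
\<close>

definition root_labelling :: "(nat \<Rightarrow> real \<Rightarrow> complex) \<Rightarrow> bool" where
  "root_labelling lam \<longleftrightarrow>
     (\<forall>k. proots (g_plus k) = {# lam 1 k, lam 2 k, lam 3 k #}) \<and>
     (\<forall>k. proots (g_minus k) = {# lam 4 k, lam 5 k, lam 6 k #}) \<and>
     (\<forall>k. \<forall>j\<in>{1, 2, 3}. lam (j + 3) k = cnj (lam j k)) \<and>
     lam 1 0 = 0 \<and>
     (lam 1 \<longlongrightarrow> 0) (at 0)"

definition Lam :: "(nat \<Rightarrow> real \<Rightarrow> complex) \<Rightarrow> nat \<Rightarrow> real \<Rightarrow> complex" where
  "Lam lam j k = (\<Sum>n\<in>{1, 2, 3} - {j}. lam n k)"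

definition Om :: "(nat \<Rightarrow> real \<Rightarrow> complex) \<Rightarrow> nat \<Rightarrow> real \<Rightarrow> complex" where
  "Om lam l k = (\<Sum>m\<in>{4, 5, 6} - {l}. lam m k)"

definition P_plus :: "(nat \<Rightarrow> real \<Rightarrow> complex) \<Rightarrow> nat \<Rightarrow> real \<Rightarrow> state_mat" where
  "P_plus lam j k =
     (let x = lam j k; L = Lam lam j k; c = complex_of_real k in
      - (x * L / (2 * (\<Prod>n\<in>{1, 2, 3} - {j}. (x - lam n k)))) *\<^sub>M
      blocks (vector
        [vector [- (1 / L ^ 2) *\<^sub>M Qp,   (1 / L) *\<^sub>M Qp,   (c / (x * L)) *\<^sub>M Qp],
         vector [- (1 / L) *\<^sub>M Qp,       Qp,               (c / x) *\<^sub>M Qp],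
         vector [(c / (x * L)) *\<^sub>M Qp,   - (c / x) *\<^sub>M Qp, - (c ^ 2 / x ^ 2) *\<^sub>M Qp]]))"

definition P_minus :: "(nat \<Rightarrow> real \<Rightarrow> complex) \<Rightarrow> nat \<Rightarrow> real \<Rightarrow> state_mat" where
  "P_minus lam l k =
     (let x = lam l k; W = Om lam l k; c = complex_of_real k in
      - (x * W / (2 * (\<Prod>m\<in>{4, 5, 6} - {l}. (x - lam m k)))) *\<^sub>M
      blocks (vector
        [vector [- (1 / W ^ 2) *\<^sub>M Qm,   (1 / W) *\<^sub>M Qm,   - (c / (x * W)) *\<^sub>M Qm],
         vector [- (1 / W) *\<^sub>M Qm,       Qm,               - (c / x) *\<^sub>M Qm],
         vector [- (c / (x * W)) *\<^sub>M Qm, (c / x) *\<^sub>M Qm,   - (c ^ 2 / x ^ 2) *\<^sub>M Qm]]))"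

definition P_formula :: "(nat \<Rightarrow> real \<Rightarrow> complex) \<Rightarrow> nat \<Rightarrow> real \<Rightarrow> state_mat" where
  "P_formula lam j k = (if j \<in> {1, 2, 3} then P_plus lam j k else P_minus lam j k)"

text \<open>
  At \<open>k = 0\<close> the formulas for \<open>P\<^sub>1\<close> and \<open>P\<^sub>4\<close> divide by \<open>\<lambda>\<^sub>1 = \<lambda>\<^sub>4 = 0\<close>; their entries are then the
  limits of the entries as \<open>k \<rightarrow> 0\<close>.
\<close>

definition P :: "(nat \<Rightarrow> real \<Rightarrow> complex) \<Rightarrow> nat \<Rightarrow> real \<Rightarrow> state_mat" where
  "P lam j k =
     (if k = 0 \<and> j \<in> {1, 4} then (\<chi> p q. Lim (at 0) (\<lambda>\<kappa>. P_formula lam j \<kappa> $ p $ q))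
      else P_formula lam j k)"

definition G_e :: "(nat \<Rightarrow> real \<Rightarrow> complex) \<Rightarrow> real \<Rightarrow> real \<Rightarrow> state_mat" where
  "G_e lam t k =
     (\<Sum>j\<in>{1, 2, 3}. exp (lam j k * of_real t) *\<^sub>M P lam j k) +
     (\<Sum>l\<in>{4, 5, 6}. exp (lam l k * of_real t) *\<^sub>M P lam l k)"

end

theory Submission
  imports Defs
begin

text \<open>
  The matrix \<open>O1\<close> is diagonalised by the projections \<open>Q\<^sub>\<plusminus> / 2\<close> onto its eigenspaces, since
  \<open>Q\<^sub>\<plusminus> O1 = \<mp>\<i> Q\<^sub>\<plusminus>\<close>. Every \<open>2 \<times> 2\<close> block of \<open>A_r k\<close> is a combination of \<open>I2\<close> and \<open>O1\<close>, so the
  \<open>6 \<times> 6\<close> system splits into two \<open>3 \<times> 3\<close> systems, one for each sign \<open>\<sigma> = \<plusminus>1\<close>, with matrix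
  \<open>N = mode_mat a \<kappa>\<close>, \<open>a = 1 + \<sigma>\<i>\<close>, \<open>\<kappa> = \<sigma>k\<close> (\<open>kron_Q_A_r\<close>). The polynomial \<open>g\<^sup>\<plusminus>\<close> is
  \<open>det (\<lambda>I + N)\<close>, so its roots are the eigenvalues of \<open>- N\<close>.

  For a simple root \<open>\<lambda>\<close> the spectral projection of \<open>- N\<close> is \<open>adj (\<lambda>I + N) / g'(\<lambda>)\<close>. The cubic
  equation turns the entries of \<open>P\<^sub>j\<close>, which involve quotients by \<open>\<lambda>\<close> and \<open>\<Lambda>\<close>, into exactly this
  adjugate, whose entries are polynomials (\<open>proj_block_formula_eq_mode_adj\<close>). That makes the limit
  \<open>k \<rightarrow> 0\<close> a matter of continuity (\<open>P_eq_branch_proj\<close>).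

  The roots are pairwise distinct for every real \<open>k\<close>, because the real part of the discriminant is
  negative (\<open>char_roots_distinct\<close>). Hence Lagrange interpolation shows that the \<open>P\<^sub>j\<close> add up to the
  identity (\<open>branch_proj_sum\<close>). Moreover each \<open>P\<^sub>j\<close> is a left eigenprojection,
  \<open>P\<^sub>j A = - \<lambda>\<^sub>j P\<^sub>j\<close>, so for a solution \<open>y\<close> every component of \<open>P\<^sub>j y\<close> solves the scalar equation
  \<open>f' = \<lambda>\<^sub>j f\<close>, and \<open>P\<^sub>j y(t) = e\<^bsup>\<lambda>\<^sub>j t\<^esup> P\<^sub>j y(0)\<close> (\<open>mode_evolution\<close>). Summation over \<open>j\<close> gives
  \<open>y(t) = G_e y(0)\<close>. This argument starts from a given solution, so it contains the uniqueness
  for the initial value problem.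
\<close>

(* Formal power series use the same symbol for coefficients; with both readings active, the
   number of parse trees of a term grows exponentially in the number of matrix entries in it. *)
no_notation fps_nth (infixl "$" 75)

section \<open>Kronecker products on the block-indexed space\<close>

definition kron :: "complex ^ 3 ^ 3 \<Rightarrow> complex ^ 2 ^ 2 \<Rightarrow> state_mat" where
  "kron C M = (\<chi> p q. C $ fst p $ fst q * M $ snd p $ snd q)"

text \<open>
  The index type \<open>3 \<times> 2\<close> identifies \<open>\<complex>\<^sup>6\<close> with \<open>\<complex>\<^sup>3 \<otimes> \<complex>\<^sup>2\<close>, so a double sum over block and
  inner index factorises.
\<close>

lemma kron_mult: "kron C M ** kron D N = kron (C ** D) (M ** N)"
proof -
  have "(\<Sum>r\<in>UNIV. (C $ i $ fst r * M $ m $ snd r) * (D $ fst r $ j * N $ snd r $ n)) =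
        (\<Sum>l\<in>UNIV. C $ i $ l * D $ l $ j) * (\<Sum>s\<in>UNIV. M $ m $ s * N $ s $ n)" for i j m n
  proof -
    have "(\<Sum>r\<in>UNIV. (C $ i $ fst r * M $ m $ snd r) * (D $ fst r $ j * N $ snd r $ n)) =
        (\<Sum>(l, s)\<in>UNIV \<times> UNIV. (C $ i $ l * D $ l $ j) * (M $ m $ s * N $ s $ n))"
      unfolding UNIV_Times_UNIV by (intro sum.cong) (auto simp: mult_ac)
    also have "\<dots> = (\<Sum>l\<in>UNIV. C $ i $ l * D $ l $ j) * (\<Sum>s\<in>UNIV. M $ m $ s * N $ s $ n)"
      by (simp add: sum_product sum.cartesian_product)
    finally show ?thesis .
  qed
  then show ?thesis
    by (simp add: kron_def matrix_matrix_mult_def vec_eq_iff)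
qed

lemma kron_scale_left: "kron (c *\<^sub>M C) M = c *\<^sub>M kron C M"
  and kron_scale_right: "kron C (c *\<^sub>M M) = c *\<^sub>M kron C M"
  and kron_add_left: "kron (C + D) M = kron C M + kron D M"
  by (simp_all add: kron_def scale_mat_def vec_eq_iff algebra_simps)

lemma scale_mat_mult: "(c *\<^sub>M M) ** N = c *\<^sub>M (M ** N)"
  by (simp add: scale_mat_def matrix_matrix_mult_def vec_eq_iff sum_distrib_left mult_ac)

lemma mult_scale_mat: "M ** (c *\<^sub>M N) = c *\<^sub>M (M ** N)"
  by (simp add: scale_mat_def matrix_matrix_mult_def vec_eq_iff sum_distrib_left mult_ac)

lemma scale_mat_vec: "((c *\<^sub>M M) *v v) $ p = c * (M *v v) $ p"
  by (simp add: scale_mat_def matrix_vector_mult_def vec_eq_iff sum_distrib_left mult_ac)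

section \<open>Reduction to two three-dimensional modes\<close>

definition Q :: "complex \<Rightarrow> complex ^ 2 ^ 2" where
  "Q \<sigma> = I2 + (\<sigma> * \<i>) *\<^sub>M O1"

lemma Qp_eq: "Qp = Q 1" and Qm_eq: "Qm = Q (- 1)"
  by (simp_all add: Qp_def Qm_def Q_def scale_mat_def vec_eq_iff)

lemma Q_O1: "\<sigma>\<^sup>2 = 1 \<Longrightarrow> Q \<sigma> ** O1 = (- (\<sigma> * \<i>)) *\<^sub>M Q \<sigma>"
  by (simp add: Q_def I2_def O1_def scale_mat_def matrix_matrix_mult_def vec_eq_iff forall_2
      sum_2 mat_def power2_eq_square algebra_simps)

text \<open>
  The matrix to which \<open>A_r k\<close> reduces when \<open>O1\<close> is replaced by its eigenvalue \<open>- \<sigma>\<i>\<close>, where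
  \<open>a = 1 + \<sigma>\<i>\<close> and \<open>\<kappa> = \<sigma>k\<close>.
\<close>

definition mode_mat :: "complex \<Rightarrow> complex \<Rightarrow> complex ^ 3 ^ 3" where
  "mode_mat a \<kappa> = vector [vector [a, 1, 0], vector [-1, 0, - \<kappa>], vector [0, \<kappa>, 0]]"

text \<open>
  The determinant of \<open>x I + mode_mat a \<kappa>\<close>. With the parameters of the two modes it is \<open>g\<^sup>+(x)\<close>
  and \<open>g\<^sup>-(x)\<close>.
\<close>

definition char_val :: "complex \<Rightarrow> complex \<Rightarrow> complex \<Rightarrow> complex" where
  "char_val a \<kappa> x = x ^ 3 + a * x\<^sup>2 + (\<kappa>\<^sup>2 + 1) * x + a * \<kappa>\<^sup>2"

definition char_deriv :: "complex \<Rightarrow> complex \<Rightarrow> complex \<Rightarrow> complex" where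
  "char_deriv a \<kappa> x = 3 * x\<^sup>2 + 2 * a * x + (\<kappa>\<^sup>2 + 1)"

text \<open>
  The adjugate of \<open>x I + mode_mat a \<kappa>\<close>.
\<close>

definition mode_adj :: "complex \<Rightarrow> complex \<Rightarrow> complex \<Rightarrow> complex ^ 3 ^ 3" where
  "mode_adj a \<kappa> x = vector
     [vector [x\<^sup>2 + \<kappa>\<^sup>2, - x,            - \<kappa>],
      vector [x,         x * (x + a),    \<kappa> * (x + a)],
      vector [- \<kappa>,       - \<kappa> * (x + a),  x\<^sup>2 + a * x + 1]]"

text \<open>
  Since \<open>A_r k = S \<otimes> I2 + T \<otimes> O1\<close> and \<open>O1\<close> acts on \<open>Q \<sigma>\<close> from the right as the scalar \<open>- \<sigma>\<i>\<close>,
  multiplication by \<open>A_r k\<close> only sees the \<open>3 \<times> 3\<close> matrix \<open>S - \<sigma>\<i> T\<close>.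
\<close>

lemma kron_Q_A_r:
  assumes "\<sigma>\<^sup>2 = 1"
  shows "kron C (Q \<sigma>) ** A_r k = kron (C ** mode_mat (1 + \<sigma> * \<i>) (\<sigma> * of_real k)) (Q \<sigma>)"
proof -
  define S :: "complex ^ 3 ^ 3"
    where "S = vector [vector [1, 1, 0], vector [-1, 0, 0], vector [0, 0, 0]]"
  define T :: "complex ^ 3 ^ 3"
    where "T = vector [vector [-1, 0, 0], vector [0, 0, - (\<i> * of_real k)],
                       vector [0, \<i> * of_real k, 0]]"
  have "A_r k = kron S I2 + kron T O1"
    unfolding vec_eq_iff split_paired_all
    by (simp add: A_r_def blocks_def kron_def S_def T_def scale_mat_def forall_3 vec_eq_iff)
  then have "kron C (Q \<sigma>) ** A_r k =
      kron (C ** S) (Q \<sigma>) + kron (C ** T) ((- (\<sigma> * \<i>)) *\<^sub>M Q \<sigma>)"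
    using Q_O1[OF assms] by (simp add: matrix_add_ldistrib kron_mult I2_def)
  also have "\<dots> = kron (C ** (S + (- (\<sigma> * \<i>)) *\<^sub>M T)) (Q \<sigma>)"
    by (simp only: matrix_add_ldistrib mult_scale_mat kron_add_left kron_scale_left kron_scale_right)
  also have "S + (- (\<sigma> * \<i>)) *\<^sub>M T = mode_mat (1 + \<sigma> * \<i>) (\<sigma> * of_real k)"
    by (simp add: vec_eq_iff forall_3 S_def T_def scale_mat_def mode_mat_def)
       (simp add: mult.assoc)
  finally show ?thesis .
qed

text \<open>
  This is \<open>adj (x I + N) (x I + N) = det (x I + N) I\<close> at a zero of the determinant.
\<close>

lemma mode_adj_left_eigen:
  assumes "char_val a \<kappa> x = 0"
  shows "mode_adj a \<kappa> x ** mode_mat a \<kappa> = (- x) *\<^sub>M mode_adj a \<kappa> x"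
  using assms
  by (simp add: vec_eq_iff forall_3 scale_mat_def mode_mat_def mode_adj_def char_val_def
      matrix_matrix_mult_def sum_3) algebra

text \<open>
  The factor \<open>1 / 2\<close> turns \<open>Q \<sigma>\<close> into a projection; the remaining quotient is the usual formula
  \<open>adj (x I + N) / g'(x)\<close> for the spectral projection of \<open>- N\<close> at a simple eigenvalue \<open>x\<close>.
\<close>

definition spec_proj :: "complex \<Rightarrow> complex \<Rightarrow> complex \<Rightarrow> state_mat" where
  "spec_proj \<sigma> \<kappa> x = (1 / (2 * char_deriv (1 + \<sigma> * \<i>) \<kappa> x)) *\<^sub>M
     kron (mode_adj (1 + \<sigma> * \<i>) \<kappa> x) (Q \<sigma>)"

lemma spec_proj_left_eigen:
  assumes "\<sigma>\<^sup>2 = 1" and "char_val (1 + \<sigma> * \<i>) (\<sigma> * of_real k) x = 0"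
  shows "spec_proj \<sigma> (\<sigma> * of_real k) x ** A_r k = (- x) *\<^sub>M spec_proj \<sigma> (\<sigma> * of_real k) x"
  using assms
  by (simp add: spec_proj_def scale_mat_mult kron_Q_A_r mode_adj_left_eigen kron_scale_left)
     (simp add: scale_mat_def vec_eq_iff)

section \<open>Simplicity of the roots and resolution of the identity\<close>

text \<open>
  Vieta's relations state that \<open>x\<close>, \<open>y\<close>, \<open>z\<close> are all the roots with multiplicity, in a form from
  which polynomial identities follow by elimination.
\<close>

definition char_roots :: "complex \<Rightarrow> complex \<Rightarrow> complex \<Rightarrow> complex \<Rightarrow> complex \<Rightarrow> bool" where
  "char_roots a \<kappa> x y z \<longleftrightarrow>
     x + y + z = - a \<and> x * y + y * z + z * x = \<kappa>\<^sup>2 + 1 \<and> x * y * z = - a * \<kappa>\<^sup>2"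

lemma char_roots_rotate: "char_roots a \<kappa> x y z \<Longrightarrow> char_roots a \<kappa> y z x"
  by (simp add: char_roots_def ac_simps)

lemma char_roots_root:
  assumes "char_roots a \<kappa> x y z"
  shows "char_val a \<kappa> x = 0"
  using assms unfolding char_val_def char_roots_def by algebra

lemma char_deriv_eq:
  assumes "char_roots a \<kappa> x y z"
  shows "char_deriv a \<kappa> x = (x - y) * (x - z)"
  using assms unfolding char_deriv_def char_roots_def by algebra

text \<open>
  Lagrange interpolation at three nodes reproduces a quadratic polynomial; the left-hand side is
  the leading coefficient of the interpolant.
\<close>

lemma lagrange_quadratic:
  fixes x y z :: "'a :: field"
  assumes "x \<noteq> y" "y \<noteq> z" "z \<noteq> x"
  shows "(\<alpha> * x\<^sup>2 + \<beta> * x + \<gamma>) / ((x - y) * (x - z)) + (\<alpha> * y\<^sup>2 + \<beta> * y + \<gamma>) / ((y - z) * (y - x))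
       + (\<alpha> * z\<^sup>2 + \<beta> * z + \<gamma>) / ((z - x) * (z - y)) = \<alpha>"
proof -
  \<comment> \<open>The Vandermonde determinant, up to sign, is a common denominator.\<close>
  define D where "D = (x - y) * (y - z) * (z - x)"
  have "x - y \<noteq> 0" "y - z \<noteq> 0" "z - x \<noteq> 0"
    using assms by auto
  then have D: "u / ((x - y) * (x - z)) = - (u * (y - z)) / D"
    "u / ((y - z) * (y - x)) = - (u * (z - x)) / D"
    "u / ((z - x) * (z - y)) = - (u * (x - y)) / D" and "D \<noteq> 0" for u
    unfolding D_def by (simp_all add: divide_simps) (simp_all add: algebra_simps)
  have "- ((\<alpha> * x\<^sup>2 + \<beta> * x + \<gamma>) * (y - z)) - (\<alpha> * y\<^sup>2 + \<beta> * y + \<gamma>) * (z - x)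
      - (\<alpha> * z\<^sup>2 + \<beta> * z + \<gamma>) * (x - y) = \<alpha> * D"
    unfolding D_def by algebra
  then show ?thesis
    using \<open>D \<noteq> 0\<close> unfolding D by (simp add: divide_simps)
qed

text \<open>
  The entries of the adjugate are polynomials of degree at most two in \<open>x\<close>, and the coefficient
  matrix of \<open>x\<^sup>2\<close> is the identity; so the claim is Lagrange interpolation in each entry.
\<close>

lemma mode_adj_resolution:
  assumes roots: "char_roots a \<kappa> x y z" and dist: "x \<noteq> y" "y \<noteq> z" "z \<noteq> x"
  shows "(1 / char_deriv a \<kappa> x) *\<^sub>M mode_adj a \<kappa> x + (1 / char_deriv a \<kappa> y) *\<^sub>M mode_adj a \<kappa> y
       + (1 / char_deriv a \<kappa> z) *\<^sub>M mode_adj a \<kappa> z = mat 1"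
proof -
  note roots' = char_roots_rotate[OF roots]
  have d: "char_deriv a \<kappa> x = (x - y) * (x - z)" "char_deriv a \<kappa> y = (y - z) * (y - x)"
    "char_deriv a \<kappa> z = (z - x) * (z - y)"
    using char_deriv_eq[OF roots] char_deriv_eq[OF roots'] char_deriv_eq[OF char_roots_rotate[OF roots']] .
  have L: "p x / ((x - y) * (x - z)) + p y / ((y - z) * (y - x)) + p z / ((z - x) * (z - y)) = \<alpha>"
    if "p = (\<lambda>x. \<alpha> * x\<^sup>2 + \<beta> * x + \<gamma>)" for p \<alpha> \<beta> \<gamma>
    using lagrange_quadratic[OF dist, of \<alpha> \<beta> \<gamma>] by (simp add: that)
  show ?thesis
    using L[of "\<lambda>x. x\<^sup>2 + \<kappa>\<^sup>2" 1 0 "\<kappa>\<^sup>2"] L[of "\<lambda>x. - x" 0 "- 1" 0] L[of "\<lambda>x. - \<kappa>" 0 0 "- \<kappa>"]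
      L[of "\<lambda>x. x" 0 1 0] L[of "\<lambda>x. x * (x + a)" 1 a 0] L[of "\<lambda>x. \<kappa> * (x + a)" 0 \<kappa> "\<kappa> * a"]
      L[of "\<lambda>x. - (\<kappa> * (x + a))" 0 "- \<kappa>" "- (\<kappa> * a)"] L[of "\<lambda>x. x\<^sup>2 + a * x + 1" 1 a 1]
    by (simp add: vec_eq_iff forall_3 scale_mat_def mode_adj_def mat_def d fun_eq_iff
        algebra_simps power2_eq_square)
qed

lemma spec_proj_sum:
  assumes roots: "char_roots (1 + \<sigma> * \<i>) \<kappa> x y z" and dist: "x \<noteq> y" "y \<noteq> z" "z \<noteq> x"
  shows "spec_proj \<sigma> \<kappa> x + spec_proj \<sigma> \<kappa> y + spec_proj \<sigma> \<kappa> z = (1 / 2) *\<^sub>M kron (mat 1) (Q \<sigma>)"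
  unfolding mode_adj_resolution[OF assms, symmetric] spec_proj_def
  by (simp add: kron_add_left kron_scale_left) (simp add: scale_mat_def vec_eq_iff field_simps)

lemma half_Q_sum_identity: "(1 / 2) *\<^sub>M kron (mat 1) (Q 1) + (1 / 2) *\<^sub>M kron (mat 1) (Q (-1)) = mat 1"
  by (auto simp: vec_eq_iff kron_def Q_def I2_def scale_mat_def mat_def prod_eq_iff field_simps)

lemma monic_cubic_vieta:
  assumes "proots [: d, c, b, 1 :] = {# x, y, z :: complex #}"
  shows "x + y + z = - b" "x * y + y * z + z * x = c" "x * y * z = - d"
proof -
  have "[: d, c, b, 1 :] = (\<Prod>w\<in>#{# x, y, z #}. [: - w, 1 :])"
    using complex_poly_decompose_multiset[of "[: d, c, b, 1 :]"] unfolding assms by simp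
  also have "\<dots> = [: - (x * y * z), x * y + y * z + z * x, - (x + y + z), 1 :]"
    by (simp add: algebra_simps)
  finally show "x + y + z = - b" "x * y + y * z + z * x = c" "x * y * z = - d" by simp_all
qed

text \<open>
  With \<open>s = k\<^sup>2\<close> the discriminant has real part \<open>16 s - 4 (s + 1)\<^sup>3\<close>, because \<open>a\<^sup>4 = - 4\<close> is real
  while \<open>a\<^sup>2 = 2\<sigma>\<i>\<close> is purely imaginary. This is negative for all \<open>s \<ge> 0\<close>.
\<close>

lemma char_roots_distinct:
  fixes k :: real
  assumes roots: "char_roots (1 + \<sigma> * \<i>) (\<sigma> * of_real k) x y z" and \<sigma>: "\<sigma>\<^sup>2 = 1"
  shows "x \<noteq> y" "y \<noteq> z" "z \<noteq> x"
proof -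
  have \<sigma>': "\<sigma> = 1 \<or> \<sigma> = - 1" using \<sigma> by (simp add: power2_eq_1_iff)
  define s where "s = k\<^sup>2"
  define a where "a = 1 + \<sigma> * \<i>"
  have a2: "a\<^sup>2 = 2 * \<sigma> * \<i>" and a4: "a ^ 4 = - 4"
    using \<sigma>' by (auto simp: a_def power2_eq_square power4_eq_xxxx algebra_simps)
  have E: "x + y + z = - a" "x * y + y * z + z * x = of_real s + 1" "x * y * z = - a * of_real s"
    using roots \<sigma> by (simp_all add: char_roots_def a_def s_def power_mult_distrib)
  define S where "S = complex_of_real s"
  \<comment> \<open>The discriminant of a cubic in terms of the elementary symmetric functions of its roots.\<close>
  have "((x - y) * (y - z) * (z - x))\<^sup>2 =
      (x + y + z)\<^sup>2 * (x * y + y * z + z * x)\<^sup>2 - 4 * (x * y + y * z + z * x) ^ 3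
      - 4 * (x + y + z) ^ 3 * (x * y * z) - 27 * (x * y * z)\<^sup>2
      + 18 * (x + y + z) * (x * y + y * z + z * x) * (x * y * z)"
    by algebra
  also have "\<dots> =
      a\<^sup>2 * (S + 1)\<^sup>2 - 4 * (S + 1) ^ 3 - 4 * a ^ 4 * S - 27 * a\<^sup>2 * S\<^sup>2 + 18 * a\<^sup>2 * (S + 1) * S"
    unfolding E S_def by algebra
  also have "\<dots> = of_real (16 * s - 4 * (s + 1) ^ 3) + \<i> * (\<sigma> * of_real (2 * (s + 1)\<^sup>2 - 54 * s\<^sup>2 + 36 * (s + 1) * s))"
    by (simp add: a2 a4 S_def algebra_simps)
  also have "Re \<dots> = 16 * s - 4 * (s + 1) ^ 3"
    using \<sigma>' by (elim disjE; simp only:; simp)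
  also have "\<dots> < 0"
  proof -
    have "s \<ge> 0" by (simp add: s_def)
    have "(s + 1) ^ 3 - 4 * s = s ^ 3 + 2 * s\<^sup>2 + (s - 1 / 2)\<^sup>2 + 3 / 4"
      by (simp add: power3_eq_cube power2_eq_square field_simps)
    moreover have "s ^ 3 \<ge> 0" using \<open>s \<ge> 0\<close> by simp
    ultimately have "(s + 1) ^ 3 - 4 * s > 0"
      using zero_le_power2[of s] zero_le_power2[of "s - 1 / 2"] by linarith
    then show ?thesis by simp
  qed
  finally have "((x - y) * (y - z) * (z - x))\<^sup>2 \<noteq> 0" by (metis less_irrefl zero_complex.simps(1))
  then show "x \<noteq> y" "y \<noteq> z" "z \<noteq> x" by auto
qed

section \<open>Evolution of a spectral component\<close>

lemma scalar_exponential_unique: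
  fixes f :: "real \<Rightarrow> complex"
  assumes "\<And>t. t \<ge> 0 \<Longrightarrow> (f has_vector_derivative x * f t) (at t within {0..})" and "t \<ge> 0"
  shows "f t = exp (x * of_real t) * f 0"
proof -
  have "((\<lambda>t. exp (- x * of_real t) * f t) has_vector_derivative 0) (at t within {0..})"
    if "t \<in> {0..}" for t
  proof -
    have "((\<lambda>t. exp (- x * of_real t)) has_vector_derivative - x * exp (- x * of_real t)) (at t within {0..})"
      by (auto intro!: derivative_eq_intros has_vector_derivative_real_field
          simp: mult_ac)
    from has_vector_derivative_mult[OF this assms(1)] that show ?thesis
      by (simp add: algebra_simps)
  qed
  then obtain c where c: "\<And>t. t \<in> {0..} \<Longrightarrow> exp (- x * of_real t) * f t = c"
    using has_vector_derivative_zero_constant[of "{0..}"] by (metis (no_types, lifting) convex_real_interval(1))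
  from c[of t] c[of 0] \<open>t \<ge> 0\<close> have "exp (- x * of_real t) * f t = f 0" by simp
  then show ?thesis by (simp add: exp_minus field_simps)
qed

text \<open>
  A left eigenmatrix decouples the system: each component of \<open>R *v y\<close> is a solution of
  \<open>f' = x f\<close>. Working from the left avoids an expansion of \<open>y\<close> in eigenvectors.
\<close>

lemma mode_evolution:
  fixes y :: "real \<Rightarrow> state"
  assumes eig: "R ** A = (- x) *\<^sub>M R"
    and ode: "\<And>t. t \<ge> 0 \<Longrightarrow> (y has_vector_derivative - (A *v y t)) (at t within {0..})"
    and "t \<ge> 0"
  shows "R *v y t = (exp (x * of_real t) *\<^sub>M R) *v y 0"
proof -
  have "(R *v y t) $ p = exp (x * of_real t) * (R *v y 0) $ p" for p
  proof (rule scalar_exponential_unique[where f = "\<lambda>t. (R *v y t) $ p"])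
    fix t :: real
    assume "t \<ge> 0"
    have "((\<lambda>t. R *v y t) has_vector_derivative R *v (- (A *v y t))) (at t within {0..})"
      by (rule bounded_linear.has_vector_derivative[OF matrix_vector_mul_bounded_linear ode[OF \<open>t \<ge> 0\<close>]])
    then have "((\<lambda>t. (R *v y t) $ p) has_vector_derivative (R *v (- (A *v y t))) $ p) (at t within {0..})"
      by (rule bounded_linear.has_vector_derivative[OF bounded_linear_vec_nth])
    moreover have "R *v (- (A *v y t)) = - ((R ** A) *v y t)"
      by (simp add: matrix_vector_mul_assoc vec.neg)
    ultimately show "((\<lambda>t. (R *v y t) $ p) has_vector_derivative x * (R *v y t) $ p) (at t within {0..})"
      by (simp add: eig scale_mat_vec)
  qed fact
  then show ?thesis
    by (simp add: vec_eq_iff scale_mat_vec)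
qed

section \<open>Identification of the matrices \<open>P\<^sub>j\<close>\<close>

lemma char_root_identities:
  assumes "char_val a \<kappa> x = 0"
  shows "(x + a) * (x\<^sup>2 + \<kappa>\<^sup>2) = - x" "\<kappa>\<^sup>2 * (x + a) = - x * (x\<^sup>2 + a * x + 1)"
  using assms unfolding char_val_def by algebra+

text \<open>
  Multiplying the prefactor \<open>x L\<close> into the matrix leaves genuine quotients only in the
  velocity-velocity entry \<open>x / L\<close> and in the magnetic-magnetic entry \<open>\<kappa>\<^sup>2 L / x\<close>. The cubic equation,
  read as \<open>L (x\<^sup>2 + \<kappa>\<^sup>2) = x\<close> and as \<open>\<kappa>\<^sup>2 L = x (x\<^sup>2 + a x + 1)\<close>, makes both of them polynomial.
  For \<open>\<sigma> = - 1\<close> the sign changes in the block formula are those of \<open>\<kappa> = - k\<close>, so one identity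
  serves both families.
\<close>

lemma proj_block_formula_eq_mode_adj:
  assumes root: "char_val a \<kappa> x = 0" and L: "L = - (x + a)" and nz: "x \<noteq> 0"
  shows "- (x * L / (2 * d)) *\<^sub>M
      blocks (vector
        [vector [- (1 / L ^ 2) *\<^sub>M M,   (1 / L) *\<^sub>M M,   (\<kappa> / (x * L)) *\<^sub>M M],
         vector [- (1 / L) *\<^sub>M M,       M,               (\<kappa> / x) *\<^sub>M M],
         vector [(\<kappa> / (x * L)) *\<^sub>M M,   - (\<kappa> / x) *\<^sub>M M, - (\<kappa> ^ 2 / x ^ 2) *\<^sub>M M]])
    = (1 / (2 * d)) *\<^sub>M kron (mode_adj a \<kappa> x) M"
proof -
  have "L * (x\<^sup>2 + \<kappa>\<^sup>2) = x" and BB: "\<kappa>\<^sup>2 * L = x * (x\<^sup>2 + a * x + 1)"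
    using char_root_identities[OF root] unfolding L by algebra+
  with nz have "L \<noteq> 0" by auto
  with \<open>L * (x\<^sup>2 + \<kappa>\<^sup>2) = x\<close> have uu: "x / L = x\<^sup>2 + \<kappa>\<^sup>2"
    by (metis nonzero_mult_div_cancel_left)
  have BB': "L * \<kappa>\<^sup>2 / x = x\<^sup>2 + a * x + 1"
    using BB nz by (simp add: field_simps)
  have EE: "x * (x + a) = - (x * L)" "\<kappa> * (x + a) = - (\<kappa> * L)"
    by (simp_all add: L algebra_simps)
  show ?thesis
    unfolding vec_eq_iff split_paired_all
    using nz \<open>L \<noteq> 0\<close>
    by (simp add: blocks_def kron_def scale_mat_def mode_adj_def forall_3 vec_eq_iff EE
        uu[symmetric] BB'[symmetric]) (simp add: field_simps power2_eq_square)
qed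

definition branch_sign :: "nat \<Rightarrow> complex" where
  "branch_sign j = (if j \<in> {1, 2, 3} then 1 else - 1)"

lemma branch_sign_square: "(branch_sign j)\<^sup>2 = 1"
  by (simp add: branch_sign_def)

text \<open>
  The value of \<open>P\<^sub>j\<close> at every frequency, \<open>k = 0\<close> included, written without division by \<open>\<lambda>\<^sub>j\<close>.
\<close>

definition branch_proj :: "(nat \<Rightarrow> real \<Rightarrow> complex) \<Rightarrow> nat \<Rightarrow> real \<Rightarrow> state_mat" where
  "branch_proj lam j k = spec_proj (branch_sign j) (branch_sign j * of_real k) (lam j k)"

text \<open>
  The factors \<open>1\<close> and \<open>- 1\<close> are kept unsimplified so that both facts are instances of the
  \<open>\<sigma>\<close>-parametrised lemmas by plain unification.
\<close>

lemma labelling_char_roots: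
  assumes "root_labelling lam"
  shows "char_roots (1 + 1 * \<i>) (1 * of_real k) (lam 1 k) (lam 2 k) (lam 3 k)"
    and "char_roots (1 + (- 1) * \<i>) (- 1 * of_real k) (lam 4 k) (lam 5 k) (lam 6 k)"
proof -
  have "proots [: (1 + \<i>) * of_real k ^ 2, of_real k ^ 2 + 1, 1 + \<i>, 1 :] = {# lam 1 k, lam 2 k, lam 3 k #}"
    "proots [: (1 - \<i>) * of_real k ^ 2, of_real k ^ 2 + 1, 1 - \<i>, 1 :] = {# lam 4 k, lam 5 k, lam 6 k #}"
    using assms by (auto simp: root_labelling_def g_plus_def g_minus_def)
  from this[THEN monic_cubic_vieta(1)] this[THEN monic_cubic_vieta(2)] this[THEN monic_cubic_vieta(3)]
  show "char_roots (1 + 1 * \<i>) (1 * of_real k) (lam 1 k) (lam 2 k) (lam 3 k)"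
    and "char_roots (1 + (- 1) * \<i>) (- 1 * of_real k) (lam 4 k) (lam 5 k) (lam 6 k)"
    by (simp_all only: char_roots_def mult_1 mult_minus1 power2_minus minus_mult_left
        diff_conv_add_uminus simp_thms)
qed

text \<open>
  Vieta's relations with \<open>\<lambda>\<^sub>j\<close> in first position, so that an argument about one root covers all six
  indices. The sum is \<open>\<Lambda>\<^sub>j\<close> or \<open>\<Omega>\<^sub>j\<close>, the product the one in the denominator of \<open>P\<^sub>j\<close>.
\<close>

lemma labelled_root:
  assumes "root_labelling lam" and "j \<in> {1, 2, 3, 4, 5, 6}"
  obtains y z where
    "char_roots (1 + branch_sign j * \<i>) (branch_sign j * of_real k) (lam j k) y z"
    "(\<Sum>n\<in>(if j \<in> {1, 2, 3} then {1, 2, 3} else {4, 5, 6}) - {j}. lam n k) = y + z"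
    "(\<Prod>n\<in>(if j \<in> {1, 2, 3} then {1, 2, 3} else {4, 5, 6}) - {j}. lam j k - lam n k)
       = (lam j k - y) * (lam j k - z)"
proof -
  have R: "{1, 2, 3} - {1} = {2, 3::nat}" "{1, 2, 3} - {2} = {3, 1::nat}"
    "{1, 2, 3} - {3} = {1, 2::nat}" "{4, 5, 6} - {4} = {5, 6::nat}"
    "{4, 5, 6} - {5} = {6, 4::nat}" "{4, 5, 6} - {6} = {4, 5::nat}"
    by auto
  note p = labelling_char_roots(1)[OF assms(1), of k] labelling_char_roots(2)[OF assms(1), of k]
  note p' = p[THEN char_roots_rotate]
  note p'' = p'[THEN char_roots_rotate]
  from assms(2) consider "j = 1" | "j = 2" | "j = 3" | "j = 4" | "j = 5" | "j = 6" by auto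
  then show thesis
  proof cases
    case 1
    show thesis by (rule that[of "lam 2 k" "lam 3 k"]) (use p 1 R in \<open>simp_all add: branch_sign_def\<close>)
  next
    case 2
    show thesis by (rule that[of "lam 3 k" "lam 1 k"]) (use p' 2 R in \<open>simp_all add: branch_sign_def\<close>)
  next
    case 3
    show thesis by (rule that[of "lam 1 k" "lam 2 k"]) (use p'' 3 R in \<open>simp_all add: branch_sign_def\<close>)
  next
    case 4
    show thesis by (rule that[of "lam 5 k" "lam 6 k"]) (use p 4 R in \<open>simp_all add: branch_sign_def\<close>)
  next
    case 5
    show thesis by (rule that[of "lam 6 k" "lam 4 k"]) (use p' 5 R in \<open>simp_all add: branch_sign_def\<close>)
  next
    case 6
    show thesis by (rule that[of "lam 4 k" "lam 5 k"]) (use p'' 6 R in \<open>simp_all add: branch_sign_def\<close>)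
  qed
qed

text \<open>
  For \<open>k \<noteq> 0\<close> the product \<open>- a k\<^sup>2\<close> of the roots does not vanish; for \<open>k = 0\<close> zero is a simple root of
  both cubics, and the labelling assigns it to \<open>\<lambda>\<^sub>1\<close> and to \<open>\<lambda>\<^sub>4\<close>.
\<close>

lemma labelled_root_nonzero:
  assumes lab: "root_labelling lam" and j: "j \<in> {1, 2, 3, 4, 5, 6}" and "k \<noteq> 0 \<or> j \<notin> {1, 4}"
  shows "lam j k \<noteq> 0"
proof (cases "k = 0")
  case False
  obtain y z where "char_roots (1 + branch_sign j * \<i>) (branch_sign j * of_real k) (lam j k) y z"
    by (rule labelled_root[OF lab j])
  moreover have "- 1 \<noteq> branch_sign j * \<i>" "branch_sign j \<noteq> 0"
    by (auto simp: branch_sign_def complex_eq_iff)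
  ultimately show ?thesis
    using False by (auto simp: char_roots_def)
next
  case True
  have "lam 1 0 = 0" "lam 4 0 = 0"
    using lab by (auto simp: root_labelling_def)
  then show ?thesis
    using True j assms(3) char_roots_distinct[OF labelling_char_roots(1)[OF lab, of 0]]
      char_roots_distinct[OF labelling_char_roots(2)[OF lab, of 0]]
    by auto
qed

lemma P_formula_eq_branch_proj:
  assumes lab: "root_labelling lam" and j: "j \<in> {1, 2, 3, 4, 5, 6}" and nz: "lam j k \<noteq> 0"
  shows "P_formula lam j k = branch_proj lam j k"
proof -
  define a \<kappa> where "a = 1 + branch_sign j * \<i>" and "\<kappa> = branch_sign j * of_real k"
  define J :: "nat set" where "J = (if j \<in> {1, 2, 3} then {1, 2, 3} else {4, 5, 6})"
  obtain y z where roots: "char_roots a \<kappa> (lam j k) y z"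
    and S: "(\<Sum>n\<in>J - {j}. lam n k) = y + z"
    and D: "(\<Prod>n\<in>J - {j}. lam j k - lam n k) = (lam j k - y) * (lam j k - z)"
    unfolding a_def \<kappa>_def J_def by (rule labelled_root[OF lab j])
  have "(\<Sum>n\<in>J - {j}. lam n k) = - (lam j k + a)"
    using roots unfolding S char_roots_def by algebra
  from proj_block_formula_eq_mode_adj[OF char_roots_root[OF roots] this nz, of "\<Prod>n\<in>J - {j}. lam j k - lam n k"]
  show ?thesis
    unfolding branch_proj_def spec_proj_def a_def[symmetric] \<kappa>_def[symmetric]
      char_deriv_eq[OF roots] D[symmetric]
    by (cases "j \<in> {1, 2, 3}")
       (simp_all only: P_formula_def P_plus_def P_minus_def Lam_def Om_def Let_def J_def \<kappa>_def
         branch_sign_def Qp_eq Qm_eq if_True if_False, simp_all)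
qed

text \<open>
  The entries are polynomials in \<open>\<kappa>\<close> and \<open>lam j \<kappa>\<close> divided by \<open>2 g'(lam j \<kappa>)\<close>, and \<open>g'(0) = 1\<close> at
  \<open>\<kappa> = 0\<close>; continuity of this single root at \<open>0\<close> is enough, as the other two roots occur only
  through \<open>g'\<close>.
\<close>

lemma branch_proj_tendsto:
  assumes "(lam j \<longlongrightarrow> 0) (at 0)" and "lam j 0 = 0"
  shows "((\<lambda>\<kappa>. branch_proj lam j \<kappa> $ p $ q) \<longlongrightarrow> branch_proj lam j 0 $ p $ q) (at 0)"
proof -
  define a where "a = 1 + branch_sign j * \<i>"
  have k: "((\<lambda>\<kappa>. branch_sign j * of_real \<kappa>) \<longlongrightarrow> 0) (at 0)"
    by (auto intro!: tendsto_eq_intros)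
  have d: "((\<lambda>\<kappa>. char_deriv a (branch_sign j * of_real \<kappa>) (lam j \<kappa>)) \<longlongrightarrow> 1) (at 0)"
    unfolding char_deriv_def by (auto intro!: tendsto_eq_intros assms(1) k)
  have m: "((\<lambda>\<kappa>. mode_adj a (branch_sign j * of_real \<kappa>) (lam j \<kappa>) $ r $ s) \<longlongrightarrow> mode_adj a 0 0 $ r $ s) (at 0)"
    for r s
  proof -
    have "\<forall>r s. ((\<lambda>\<kappa>. mode_adj a (branch_sign j * of_real \<kappa>) (lam j \<kappa>) $ r $ s) \<longlongrightarrow> mode_adj a 0 0 $ r $ s) (at 0)"
      unfolding forall_3 mode_adj_def vector_3
      by (intro conjI; (rule tendsto_eq_intros assms(1) k refl)+; simp)
    then show ?thesis by blast
  qed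
  have "((\<lambda>\<kappa>. 1 / (2 * char_deriv a (branch_sign j * of_real \<kappa>) (lam j \<kappa>))) \<longlongrightarrow> 1 / (2 * 1)) (at 0)"
    by (intro tendsto_intros d) simp
  from tendsto_mult[OF this tendsto_mult[OF m tendsto_const]] show ?thesis
    unfolding branch_proj_def spec_proj_def a_def[symmetric] assms(2)
    by (simp add: scale_mat_def kron_def char_deriv_def[of _ 0 0])
qed

text \<open>
  At \<open>k = 0\<close> the limit in the definition of \<open>P\<close> exists because the quotient formula agrees with
  \<open>branch_proj\<close> at all \<open>\<kappa> \<noteq> 0\<close>.
\<close>

lemma P_eq_branch_proj:
  assumes lab: "root_labelling lam" and j: "j \<in> {1, 2, 3, 4, 5, 6}"
  shows "P lam j k = branch_proj lam j k"
proof (cases "k = 0 \<and> j \<in> {1, 4}")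
  case False
  then show ?thesis
    using P_formula_eq_branch_proj[OF lab j] labelled_root_nonzero[OF lab j] by (auto simp: P_def)
next
  case True
  have lim1: "(lam 1 \<longlongrightarrow> 0) (at 0)" and "lam 1 0 = 0" and c: "lam 4 = (\<lambda>k. cnj (lam 1 k))"
    using lab by (auto simp: root_labelling_def)
  then have "(lam j \<longlongrightarrow> 0) (at 0)" and "lam j 0 = 0"
    using True tendsto_cnj[OF lim1] by auto
  then have "((\<lambda>\<kappa>. branch_proj lam j \<kappa> $ p $ q) \<longlongrightarrow> branch_proj lam j 0 $ p $ q) (at 0)" for p q
    by (rule branch_proj_tendsto)
  moreover have "\<forall>\<^sub>F \<kappa> in at 0. branch_proj lam j \<kappa> $ p $ q = P_formula lam j \<kappa> $ p $ q" for p q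
    using P_formula_eq_branch_proj[OF lab j] labelled_root_nonzero[OF lab j]
    by (auto simp: eventually_at_filter)
  ultimately have "((\<lambda>\<kappa>. P_formula lam j \<kappa> $ p $ q) \<longlongrightarrow> branch_proj lam j 0 $ p $ q) (at 0)" for p q
    by (rule Lim_transform_eventually)
  then have "Lim (at 0) (\<lambda>\<kappa>. P_formula lam j \<kappa> $ p $ q) = branch_proj lam j 0 $ p $ q" for p q
    by (intro tendsto_Lim) auto
  then show ?thesis
    using True by (simp add: P_def vec_eq_iff)
qed

lemma branch_proj_sum:
  assumes lab: "root_labelling lam"
  shows "(\<Sum>j\<in>{1, 2, 3}. branch_proj lam j k) + (\<Sum>l\<in>{4, 5, 6}. branch_proj lam l k) = mat 1"
proof -
  note r = labelling_char_roots[OF lab, of k]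
  show ?thesis
    unfolding half_Q_sum_identity[symmetric]
      spec_proj_sum[OF r(1) char_roots_distinct[OF r(1)], simplified, symmetric]
      spec_proj_sum[OF r(2) char_roots_distinct[OF r(2)], simplified, symmetric]
    by (simp add: branch_proj_def branch_sign_def add.assoc)
qed

section \<open>Representation of the solution\<close>

theorem proposition2p7:
  fixes u E B :: "real \<Rightarrow> real \<Rightarrow> complex ^ 2"
    and u0 E0 B0 :: "real \<Rightarrow> complex ^ 2"
    and lam :: "nat \<Rightarrow> real \<Rightarrow> complex"
  assumes roots: "root_labelling lam"
    and ode: "\<And>t k. t \<ge> 0 \<Longrightarrow>
      ((\<lambda>s. stack (u s k) (E s k) (B s k)) has_vector_derivative
        - (A_r k *v stack (u t k) (E t k) (B t k))) (at t within {0..})"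
    and init: "\<And>k. u 0 k = u0 k" "\<And>k. E 0 k = E0 k" "\<And>k. B 0 k = B0 k"
  shows "\<forall>t\<ge>0. \<forall>k. stack (u t k) (E t k) (B t k) = G_e lam t k *v stack (u0 k) (E0 k) (B0 k)"
proof (intro allI impI)
  fix t k :: real
  assume t: "t \<ge> 0"
  define y where "y s = stack (u s k) (E s k) (B s k)" for s
  have y: "(y has_vector_derivative - (A_r k *v y s)) (at s within {0..})" if "s \<ge> 0" for s
    unfolding y_def using ode[OF that] .
  have evo: "branch_proj lam j k *v y t = (exp (lam j k * of_real t) *\<^sub>M P lam j k) *v y 0"
    if j: "j \<in> {1, 2, 3, 4, 5, 6}" for j
  proof -
    obtain y' z' where "char_roots (1 + branch_sign j * \<i>) (branch_sign j * of_real k) (lam j k) y' z'"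
      by (rule labelled_root[OF roots j])
    from spec_proj_left_eigen[OF branch_sign_square char_roots_root[OF this]]
    have "branch_proj lam j k ** A_r k = (- lam j k) *\<^sub>M branch_proj lam j k"
      unfolding branch_proj_def .
    from mode_evolution[OF this y t] show ?thesis
      unfolding P_eq_branch_proj[OF roots j] .
  qed
  have "y t = mat 1 *v y t" by simp
  also have "\<dots> = G_e lam t k *v y 0"
    using evo unfolding branch_proj_sum[OF roots, of k, symmetric] G_e_def
    by (simp add: matrix_vector_mult_add_rdistrib)
  finally show "stack (u t k) (E t k) (B t k) = G_e lam t k *v stack (u0 k) (E0 k) (B0 k)"
    by (simp add: y_def init)
qed

end
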